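(* Let $(X,\mathfrak A,\mathsf m)$ be a $\sigma$-finite measure space and let $E\colon L^2(\mathsf m)\to(-\infty,\infty]$ be a proper convex lower semicontinuous functional with domain $D(E)=\{u: E(u)<\infty\}$. For $\alpha>0$ and $s,t\in\mathbb R$ put $$h_\alpha^+(s,t)=s\wedge(t+\alpha),\quad k_\alpha^+(s,t)=t\vee(s-\alpha),\quad h_\alpha^-(s,t)=s\vee(t-\alpha),\quad k_\alpha^-(s,t)=t\wedge(s+\alpha).$$ Consider the two properties: (U) (strong upper unit-contraction property) for all $u,v\in D(E)$ and $\alpha>0$: $h_\alpha^+(u,v),k_\alpha^+(u,v)\in D(E)$ and $E(h_\alpha^+(u,v))+E(k_\alpha^+(u,v))\le E(u)+E(v)$; (L) (strong lower unit-contraction property) for all $u,v\in D(E)$ and $\alpha>0$: $h_\alpha^-(u,v),k_\alpha^-(u,v)\in D(E)$ and $E(h_\alpha^-(u,v))+E(k_\alpha^-(u,v))\le E(u)+E(v)$. Then $E$ is Markovian if and only if it has any one of the properties (U), (L) (that is, Markovian $\iff$ (U), and Markovian $\iff$ (L)).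
   Context: $L^2(\mathsf m)$ is the real Lebesgue space; $\wedge,\vee$ are pointwise minimum and maximum, and $h^\pm_\alpha(u,v)$, $k^\pm_\alpha(u,v)$ denote pointwise a.e. composition. A functional $E\colon L^2(\mathsf m)\to(-\infty,\infty]$ is proper if $D(E)\neq\emptyset$. Set $C_\le=\{(u,v)\in L^2\oplus L^2: u\le v \text{ a.e.}\}$ and, for $\alpha\in[0,\infty]$, $C_\alpha=\{(u,v)\in L^2\oplus L^2: |u-v|\le\alpha\text{ a.e.}\}$. These are closed convex sets; let $P_\le$ and $P_\alpha$ be the metric (closest-point) projections of the Hilbert space $L^2\oplus L^2$ onto $C_\le$ and $C_\alpha$. Let $E^{\oplus2}(u,v)=E(u)+E(v)$. $E$ is Markovian if both $E^{\oplus2}(P_\le w)\le E^{\oplus2}(w)$ for all $w\in L^2\oplus L^2$, and $E^{\oplus2}(P_\alpha w)\le E^{\oplus2}(w)$ for all $w\in L^2\oplus L^2$ and all $\alpha\in[0,\infty]$. *)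

theory Defs
  imports "HOL-Analysis.Analysis"
begin

text \<open>
  Elements of the real Lebesgue space are handled through their measurable, square-integrable
  representatives; \<open>L2_dist\<close> is the norm distance, so it identifies functions that agree
  almost everywhere. A functional on the Lebesgue space is therefore a function on
  representatives that is invariant under almost everywhere equality (\<open>L2_functional\<close>).
\<close>

definition L2 :: "'a measure \<Rightarrow> ('a \<Rightarrow> real) set" where
  "L2 M = {u \<in> borel_measurable M. integrable M (\<lambda>x. (u x)\<^sup>2)}"

definition L2_dist :: "'a measure \<Rightarrow> ('a \<Rightarrow> real) \<Rightarrow> ('a \<Rightarrow> real) \<Rightarrow> real" where
  "L2_dist M u v = sqrt (\<integral>x. (u x - v x)\<^sup>2 \<partial>M)"

text \<open>Values of functionals outside \<open>L2 M\<close> are irrelevant and left unconstrained.\<close>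

definition L2_functional :: "'a measure \<Rightarrow> (('a \<Rightarrow> real) \<Rightarrow> ereal) \<Rightarrow> bool" where
  "L2_functional M E \<longleftrightarrow>
     (\<forall>u\<in>L2 M. E u \<noteq> -\<infinity>) \<and>
     (\<forall>u\<in>L2 M. \<forall>v\<in>L2 M. (AE x in M. u x = v x) \<longrightarrow> E u = E v)"

definition dom_fun :: "'a measure \<Rightarrow> (('a \<Rightarrow> real) \<Rightarrow> ereal) \<Rightarrow> ('a \<Rightarrow> real) set" where
  "dom_fun M E = {u \<in> L2 M. E u < \<infinity>}"

definition proper_fun :: "'a measure \<Rightarrow> (('a \<Rightarrow> real) \<Rightarrow> ereal) \<Rightarrow> bool" where
  "proper_fun M E \<longleftrightarrow> dom_fun M E \<noteq> {}"

definition convex_fun :: "'a measure \<Rightarrow> (('a \<Rightarrow> real) \<Rightarrow> ereal) \<Rightarrow> bool" where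
  "convex_fun M E \<longleftrightarrow>
     (\<forall>u\<in>L2 M. \<forall>v\<in>L2 M. \<forall>t::real. 0 < t \<and> t < 1 \<longrightarrow>
        E (\<lambda>x. (1 - t) * u x + t * v x) \<le> ereal (1 - t) * E u + ereal t * E v)"

definition lsc_fun :: "'a measure \<Rightarrow> (('a \<Rightarrow> real) \<Rightarrow> ereal) \<Rightarrow> bool" where
  "lsc_fun M E \<longleftrightarrow>
     (\<forall>u\<in>L2 M. \<forall>c. c < E u \<longrightarrow>
        (\<exists>\<delta>>0. \<forall>v\<in>L2 M. L2_dist M u v < \<delta> \<longrightarrow> c < E v))"

definition L2_sum_dist ::
  "'a measure \<Rightarrow> ('a \<Rightarrow> real) \<times> ('a \<Rightarrow> real) \<Rightarrow> ('a \<Rightarrow> real) \<times> ('a \<Rightarrow> real) \<Rightarrow> real" where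
  "L2_sum_dist M w z = sqrt ((L2_dist M (fst w) (fst z))\<^sup>2 + (L2_dist M (snd w) (snd z))\<^sup>2)"

text \<open>
  The analogue of \<^const>\<open>closest_point\<close> for the direct sum of two copies of the Lebesgue
  space. On nonempty closed convex sets the closest point is determined up to almost everywhere
  equality; the choice operator only selects a representative.
\<close>

definition L2_proj ::
  "'a measure \<Rightarrow> (('a \<Rightarrow> real) \<times> ('a \<Rightarrow> real)) set \<Rightarrow>
     ('a \<Rightarrow> real) \<times> ('a \<Rightarrow> real) \<Rightarrow> ('a \<Rightarrow> real) \<times> ('a \<Rightarrow> real)" where
  "L2_proj M C w = (SOME p. p \<in> C \<and> (\<forall>q\<in>C. L2_sum_dist M w p \<le> L2_sum_dist M w q))"

definition C_le :: "'a measure \<Rightarrow> (('a \<Rightarrow> real) \<times> ('a \<Rightarrow> real)) set" where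
  "C_le M = {(u, v). u \<in> L2 M \<and> v \<in> L2 M \<and> (AE x in M. u x \<le> v x)}"

definition C_dist :: "'a measure \<Rightarrow> ennreal \<Rightarrow> (('a \<Rightarrow> real) \<times> ('a \<Rightarrow> real)) set" where
  "C_dist M \<alpha> =
     {(u, v). u \<in> L2 M \<and> v \<in> L2 M \<and> (AE x in M. ennreal \<bar>u x - v x\<bar> \<le> \<alpha>)}"

definition double_fun ::
  "(('a \<Rightarrow> real) \<Rightarrow> ereal) \<Rightarrow> ('a \<Rightarrow> real) \<times> ('a \<Rightarrow> real) \<Rightarrow> ereal" where
  "double_fun E w = E (fst w) + E (snd w)"

definition markovian :: "'a measure \<Rightarrow> (('a \<Rightarrow> real) \<Rightarrow> ereal) \<Rightarrow> bool" where
  "markovian M E \<longleftrightarrow>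
     (\<forall>w \<in> L2 M \<times> L2 M. double_fun E (L2_proj M (C_le M) w) \<le> double_fun E w) \<and>
     (\<forall>w \<in> L2 M \<times> L2 M. \<forall>\<alpha>::ennreal.
        double_fun E (L2_proj M (C_dist M \<alpha>) w) \<le> double_fun E w)"

definition h_plus :: "real \<Rightarrow> real \<Rightarrow> real \<Rightarrow> real" where
  "h_plus \<alpha> s t = min s (t + \<alpha>)"

definition k_plus :: "real \<Rightarrow> real \<Rightarrow> real \<Rightarrow> real" where
  "k_plus \<alpha> s t = max t (s - \<alpha>)"

definition h_minus :: "real \<Rightarrow> real \<Rightarrow> real \<Rightarrow> real" where
  "h_minus \<alpha> s t = max s (t - \<alpha>)"

definition k_minus :: "real \<Rightarrow> real \<Rightarrow> real \<Rightarrow> real" where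
  "k_minus \<alpha> s t = min t (s + \<alpha>)"

definition strong_upper_unit_contraction ::
  "'a measure \<Rightarrow> (('a \<Rightarrow> real) \<Rightarrow> ereal) \<Rightarrow> bool" where
  "strong_upper_unit_contraction M E \<longleftrightarrow>
     (\<forall>u \<in> dom_fun M E. \<forall>v \<in> dom_fun M E. \<forall>\<alpha>>0.
        (\<lambda>x. h_plus \<alpha> (u x) (v x)) \<in> dom_fun M E \<and>
        (\<lambda>x. k_plus \<alpha> (u x) (v x)) \<in> dom_fun M E \<and>
        E (\<lambda>x. h_plus \<alpha> (u x) (v x)) + E (\<lambda>x. k_plus \<alpha> (u x) (v x)) \<le> E u + E v)"

definition strong_lower_unit_contraction ::
  "'a measure \<Rightarrow> (('a \<Rightarrow> real) \<Rightarrow> ereal) \<Rightarrow> bool" where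
  "strong_lower_unit_contraction M E \<longleftrightarrow>
     (\<forall>u \<in> dom_fun M E. \<forall>v \<in> dom_fun M E. \<forall>\<alpha>>0.
        (\<lambda>x. h_minus \<alpha> (u x) (v x)) \<in> dom_fun M E \<and>
        (\<lambda>x. k_minus \<alpha> (u x) (v x)) \<in> dom_fun M E \<and>
        E (\<lambda>x. h_minus \<alpha> (u x) (v x)) + E (\<lambda>x. k_minus \<alpha> (u x) (v x)) \<le> E u + E v)"

end

theory Submission
  imports Defs
begin

text \<open>
  Both projections move a pair \<open>(u, v)\<close> to \<open>(u - d, v + d)\<close> for a suitable function \<open>d\<close>,
  and the pairs in (U) and (L) are reflections, which move twice as far as the projection onto
  a half space \<open>{u - v \<le> \<alpha>}\<close>. Hence (U) gives the projection inequalities by convexity, the case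
  \<open>\<alpha> = 0\<close> by lower semicontinuity, and \<open>P\<^sub>\<alpha>\<close> by composing the projections onto two half spaces.

  Conversely, put \<open>\<phi> t = E (u - t d)\<close> and \<open>\<psi> s = E (v + s d)\<close>, where \<open>d\<close> is the displacement of the
  reflection. The projection inequality for the pair with \<open>t = i/n\<close> and
  \<open>s = (n - 2 - i)/n\<close> says that advancing both parameters by \<open>1/n\<close> does not increase the sum;
  adding these inequalities over \<open>i\<close> telescopes to the reflection inequality up to an error
  that vanishes as \<open>n\<close> grows. For \<open>P\<^sub>\<alpha>\<close> this works only if \<open>u \<ge> v\<close>; the general case
  follows from the pair \<open>(max u v, v)\<close> and the inequality
  \<open>E (min f g) + E (max f g) \<le> E f + E g\<close>.
\<close>

section \<open>The Lebesgue space\<close>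

lemma L2_measurable: "u \<in> L2 M \<Longrightarrow> u \<in> borel_measurable M"
  by (simp add: L2_def)

lemma L2_integrable: "u \<in> L2 M \<Longrightarrow> integrable M (\<lambda>x. (u x)\<^sup>2)"
  by (simp add: L2_def)

lemma L2_dominated:
  assumes g: "g \<in> L2 M" and f: "f \<in> borel_measurable M" and le: "\<And>x. \<bar>f x\<bar> \<le> \<bar>g x\<bar>"
  shows "f \<in> L2 M"
proof -
  have "integrable M (\<lambda>x. (f x)\<^sup>2)"
  proof (rule Bochner_Integration.integrable_bound)
    show "integrable M (\<lambda>x. (g x)\<^sup>2)"
      using g by (rule L2_integrable)
    show "(\<lambda>x. (f x)\<^sup>2) \<in> borel_measurable M"
      using f by measurable
    show "AE x in M. norm ((f x)\<^sup>2) \<le> norm ((g x)\<^sup>2)"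
      using le by (simp add: abs_le_square_iff)
  qed
  with f show ?thesis
    by (simp add: L2_def)
qed

lemma L2_scale: "u \<in> L2 M \<Longrightarrow> (\<lambda>x. c * u x) \<in> L2 M"
  unfolding L2_def by (simp add: power_mult_distrib borel_measurable_times)

lemma L2_add:
  assumes u: "u \<in> L2 M" and v: "v \<in> L2 M"
  shows "(\<lambda>x. u x + v x) \<in> L2 M"
proof -
  note [measurable] = L2_measurable[OF u] L2_measurable[OF v]
  have "integrable M (\<lambda>x. (u x + v x)\<^sup>2)"
  proof (rule Bochner_Integration.integrable_bound)
    show "integrable M (\<lambda>x. 2 * (u x)\<^sup>2 + 2 * (v x)\<^sup>2)"
      using L2_integrable[OF u] L2_integrable[OF v] by simp
    have "(u x + v x)\<^sup>2 \<le> 2 * (u x)\<^sup>2 + 2 * (v x)\<^sup>2" for x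
      using zero_le_power2[of "u x - v x"] by (simp add: power2_eq_square algebra_simps)
    then show "AE x in M. norm ((u x + v x)\<^sup>2) \<le> norm (2 * (u x)\<^sup>2 + 2 * (v x)\<^sup>2)"
      by simp
  qed measurable
  then show ?thesis
    by (simp add: L2_def)
qed

lemma L2_add_scale: "u \<in> L2 M \<Longrightarrow> d \<in> L2 M \<Longrightarrow> (\<lambda>x. u x + c * d x) \<in> L2 M"
  by (intro L2_add L2_scale)

lemma L2_diff: "u \<in> L2 M \<Longrightarrow> v \<in> L2 M \<Longrightarrow> (\<lambda>x. u x - v x) \<in> L2 M"
  using L2_add_scale[of u M v "-1"] by simp

lemma L2_diff_scale: "u \<in> L2 M \<Longrightarrow> d \<in> L2 M \<Longrightarrow> (\<lambda>x. u x - c * d x) \<in> L2 M"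
  by (intro L2_diff L2_scale)

lemma L2_dist_eq_0_iff:
  assumes "u \<in> L2 M" "v \<in> L2 M"
  shows "L2_dist M u v = 0 \<longleftrightarrow> (AE x in M. u x = v x)"
  using integral_nonneg_eq_0_iff_AE[OF L2_integrable[OF L2_diff[OF assms]]]
  by (simp add: L2_dist_def)

text \<open>Dominated convergence for the squared error, with the square of \<open>g\<close> as
  majorant. Convergence at every point can be asked for because the approximations used below are
  explicit formulas.\<close>

lemma L2_dist_tendsto_0:
  assumes u: "u \<in> L2 M" and f: "\<And>n. f n \<in> L2 M" and g: "g \<in> L2 M"
    and lim: "\<And>x. (\<lambda>n. f n x) \<longlonglongrightarrow> u x"
    and le: "\<And>n x. \<bar>u x - f n x\<bar> \<le> \<bar>g x\<bar>"
  shows "(\<lambda>n. L2_dist M u (f n)) \<longlonglongrightarrow> 0"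
proof -
  note [measurable] = L2_measurable[OF u] L2_measurable[OF f]
  have "(\<lambda>n. \<integral>x. (u x - f n x)\<^sup>2 \<partial>M) \<longlonglongrightarrow> (\<integral>x. 0 \<partial>M)"
  proof (rule integral_dominated_convergence)
    show "integrable M (\<lambda>x. (g x)\<^sup>2)"
      using g by (rule L2_integrable)
    have "(\<lambda>n. (u x - f n x)\<^sup>2) \<longlonglongrightarrow> (u x - u x)\<^sup>2" for x
      by (intro tendsto_intros lim)
    then show "AE x in M. (\<lambda>n. (u x - f n x)\<^sup>2) \<longlonglongrightarrow> 0"
      by simp
    show "AE x in M. norm ((u x - f n x)\<^sup>2) \<le> (g x)\<^sup>2" for n
      using le by (simp add: abs_le_square_iff)
  qed measurable
  then have "(\<lambda>n. sqrt (\<integral>x. (u x - f n x)\<^sup>2 \<partial>M)) \<longlonglongrightarrow> sqrt 0"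
    by (intro tendsto_intros) simp
  then show ?thesis
    by (simp add: L2_dist_def)
qed

section \<open>The projections\<close>

lemma L2_sum_dist_eq:
  "L2_sum_dist M (u, v) (p, q) = sqrt ((\<integral>x. (u x - p x)\<^sup>2 \<partial>M) + (\<integral>x. (v x - q x)\<^sup>2 \<partial>M))"
  by (simp add: L2_sum_dist_def L2_dist_def)

text \<open>
  The last assumption is the variational inequality for the projection of \<open>u - v\<close> onto the
  set of admissible differences \<open>p - q\<close>.
\<close>

lemma L2_proj_shift:
  assumes C: "C \<subseteq> L2 M \<times> L2 M" and u: "u \<in> L2 M" and v: "v \<in> L2 M" and d: "d \<in> L2 M"
    and mem: "((\<lambda>x. u x - d x), (\<lambda>x. v x + d x)) \<in> C"
    and var: "\<And>p q. (p, q) \<in> C \<Longrightarrow>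
      AE x in M. 0 \<le> d x * ((u x - d x) - (v x + d x) - (p x - q x))"
  shows "\<exists>p q. L2_proj M C (u, v) = (p, q) \<and> (p, q) \<in> C \<and>
    (AE x in M. p x = u x - d x) \<and> (AE x in M. q x = v x + d x)"
proof -
  define a where "a = (\<lambda>x. u x - d x)"
  define b where "b = (\<lambda>x. v x + d x)"
  have a: "a \<in> L2 M" and b: "b \<in> L2 M"
    using L2_diff[OF u d] L2_add[OF v d] by (simp_all add: a_def b_def)
  let ?S = "\<lambda>f g :: 'a \<Rightarrow> real. \<integral>x. (f x - g x)\<^sup>2 \<partial>M"
  \<comment> \<open>The integrands differ by exactly twice the expression in \<open>var\<close>,
    since \<open>u - a = d\<close> and \<open>v - b = - d\<close>. The extra terms on the left give
    uniqueness in addition to minimality.\<close>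
  have pyth: "?S u a + ?S v b + (?S a p + ?S b q) \<le> ?S u p + ?S v q"
    if pq: "(p, q) \<in> C" for p q
  proof -
    have p: "p \<in> L2 M" and q: "q \<in> L2 M"
      using pq C by auto
    note i = L2_integrable[OF L2_diff[OF u a]] L2_integrable[OF L2_diff[OF v b]]
      L2_integrable[OF L2_diff[OF a p]] L2_integrable[OF L2_diff[OF b q]]
      L2_integrable[OF L2_diff[OF u p]] L2_integrable[OF L2_diff[OF v q]]
    have "?S u a + ?S v b + (?S a p + ?S b q) =
      (\<integral>x. (u x - a x)\<^sup>2 + (v x - b x)\<^sup>2 + ((a x - p x)\<^sup>2 + (b x - q x)\<^sup>2) \<partial>M)"
      using i by simp
    also have "\<dots> \<le> (\<integral>x. (u x - p x)\<^sup>2 + (v x - q x)\<^sup>2 \<partial>M)"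
    proof (rule integral_mono_AE)
      show "AE x in M. (u x - a x)\<^sup>2 + (v x - b x)\<^sup>2 + ((a x - p x)\<^sup>2 + (b x - q x)\<^sup>2)
          \<le> (u x - p x)\<^sup>2 + (v x - q x)\<^sup>2"
        using var[OF pq]
      proof eventually_elim
        case (elim x)
        then show ?case
          by (simp add: a_def b_def power2_eq_square algebra_simps)
      qed
    qed (use i in simp_all)
    also have "\<dots> = ?S u p + ?S v q"
      using i by simp
    finally show ?thesis .
  qed
  have nonneg: "0 \<le> ?S f g" for f g
    by (rule Bochner_Integration.integral_nonneg) simp
  have "L2_sum_dist M (u, v) (a, b) \<le> L2_sum_dist M (u, v) z" if "z \<in> C" for z
    using pyth[of "fst z" "snd z"] that
      add_nonneg_nonneg[OF nonneg[of a "fst z"] nonneg[of b "snd z"]]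
    by (cases z) (simp add: L2_sum_dist_eq del: Bochner_Integration.integral_nonneg)
  then have "\<exists>z. z \<in> C \<and> (\<forall>z'\<in>C. L2_sum_dist M (u, v) z \<le> L2_sum_dist M (u, v) z')"
    using mem unfolding a_def b_def by blast
  then have min: "L2_proj M C (u, v) \<in> C \<and>
      (\<forall>z'\<in>C. L2_sum_dist M (u, v) (L2_proj M C (u, v)) \<le> L2_sum_dist M (u, v) z')"
    unfolding L2_proj_def by (rule someI_ex)
  obtain p q where pq: "L2_proj M C (u, v) = (p, q)"
    by fastforce
  then have pqC: "(p, q) \<in> C"
    using min by simp
  then have p: "p \<in> L2 M" and q: "q \<in> L2 M"
    using C by auto
  have "(a, b) \<in> C"
    using mem by (simp add: a_def b_def)
  then have "L2_sum_dist M (u, v) (p, q) \<le> L2_sum_dist M (u, v) (a, b)"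
    using min pq by auto
  then have "?S u p + ?S v q \<le> ?S u a + ?S v b"
    by (simp add: L2_sum_dist_eq)
  \<comment> \<open>The minimiser picked by the choice operator is no farther away than
    \<open>(a, b)\<close>, so the extra terms of \<open>pyth\<close> must vanish.\<close>
  with pyth[OF pqC] nonneg[of a p] nonneg[of b q] have "?S a p = 0" "?S b q = 0"
    by linarith+
  then have "L2_dist M a p = 0" "L2_dist M b q = 0"
    by (simp_all add: L2_dist_def)
  then have "AE x in M. a x = p x" "AE x in M. b x = q x"
    using L2_dist_eq_0_iff a b p q by blast+
  then have "AE x in M. p x = u x - d x" "AE x in M. q x = v x + d x"
    by (auto simp: a_def b_def)
  then show ?thesis
    using pq pqC by blast
qed

text \<open>The displacement of the reflection in the half space \<open>u - v \<le> a\<close>: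
  shifting by it gives pointwise twice the projection minus the original pair, so shifting by half
  of it gives the projection.\<close>

definition excess :: "real \<Rightarrow> ('a \<Rightarrow> real) \<Rightarrow> ('a \<Rightarrow> real) \<Rightarrow> 'a \<Rightarrow> real" where
  "excess a u v = (\<lambda>x. max 0 (u x - v x - a))"

text \<open>For nonnegative \<open>a\<close> the two excesses never act at the same point, so the
  projection onto the strip can be checked wall by wall.\<close>

lemma excess_cases [consumes 1, case_names above below inside]:
  assumes "0 \<le> a"
  obtains (above) "excess a u v x = u x - v x - a" "excess a v u x = 0" "u x - v x > a"
    | (below) "excess a u v x = 0" "excess a v u x = v x - u x - a" "v x - u x > a"
    | (inside) "excess a u v x = 0" "excess a v u x = 0" "\<bar>u x - v x\<bar> \<le> a"
proof -
  consider "u x - v x > a" | "v x - u x > a" | "\<bar>u x - v x\<bar> \<le> a"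
    by linarith
  then show thesis
    using assms above below inside by cases (simp_all add: excess_def)
qed

lemma L2_excess:
  assumes u: "u \<in> L2 M" and v: "v \<in> L2 M" and "0 \<le> a"
  shows "excess a u v \<in> L2 M"
proof (rule L2_dominated[OF L2_diff[OF u v]])
  note [measurable] = L2_measurable[OF u] L2_measurable[OF v]
  show "excess a u v \<in> borel_measurable M"
    unfolding excess_def by measurable
  show "\<bar>excess a u v x\<bar> \<le> \<bar>u x - v x\<bar>" for x
    using \<open>0 \<le> a\<close> by (simp add: excess_def)
qed

text \<open>The projections and the pairs in (U) all preserve \<open>u + v\<close>, so a single
  displacement \<open>d\<close> describes each of them and every contraction inequality takes this
  form.\<close>

definition shift_contracts ::
  "(('a \<Rightarrow> real) \<Rightarrow> ereal) \<Rightarrow> ('a \<Rightarrow> real) \<Rightarrow> ('a \<Rightarrow> real) \<Rightarrow> ('a \<Rightarrow> real) \<Rightarrow> bool" where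
  "shift_contracts E u v d \<longleftrightarrow> E (\<lambda>x. u x - d x) + E (\<lambda>x. v x + d x) \<le> E u + E v"

text \<open>The projection is known only up to a null set; invariance of \<open>E\<close> under
  almost everywhere equality allows it to be replaced by the explicit shift.\<close>

lemma double_fun_L2_proj:
  assumes E: "L2_functional M E"
    and C: "C \<subseteq> L2 M \<times> L2 M" and u: "u \<in> L2 M" and v: "v \<in> L2 M" and d: "d \<in> L2 M"
    and mem: "((\<lambda>x. u x - d x), (\<lambda>x. v x + d x)) \<in> C"
    and var: "\<And>p q. (p, q) \<in> C \<Longrightarrow>
      AE x in M. 0 \<le> d x * ((u x - d x) - (v x + d x) - (p x - q x))"
  shows "double_fun E (L2_proj M C (u, v)) \<le> double_fun E (u, v) \<longleftrightarrow> shift_contracts E u v d"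
proof -
  obtain p q where pq: "L2_proj M C (u, v) = (p, q)" "(p, q) \<in> C"
    and AE: "AE x in M. p x = u x - d x" "AE x in M. q x = v x + d x"
    using L2_proj_shift[OF C u v d mem var] by blast
  have p: "p \<in> L2 M" and q: "q \<in> L2 M"
    using pq(2) C by auto
  note cong = conjunct2[OF E[unfolded L2_functional_def], rule_format]
  have "E p = E (\<lambda>x. u x - d x)"
    using p L2_diff[OF u d] AE(1) by (rule cong)
  moreover have "E q = E (\<lambda>x. v x + d x)"
    using q L2_add[OF v d] AE(2) by (rule cong)
  ultimately show ?thesis
    by (simp add: double_fun_def shift_contracts_def pq(1))
qed

lemma double_fun_proj_le:
  assumes E: "L2_functional M E" and u: "u \<in> L2 M" and v: "v \<in> L2 M"
  shows "double_fun E (L2_proj M (C_le M) (u, v)) \<le> double_fun E (u, v) \<longleftrightarrow>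
    shift_contracts E u v (\<lambda>x. excess 0 u v x / 2)"
proof (rule double_fun_L2_proj[OF E _ u v])
  show "C_le M \<subseteq> L2 M \<times> L2 M"
    by (auto simp: C_le_def)
  show d: "(\<lambda>x. excess 0 u v x / 2) \<in> L2 M"
    using L2_scale[OF L2_excess[OF u v, of 0], of "1/2"] by simp
  show "((\<lambda>x. u x - excess 0 u v x / 2), (\<lambda>x. v x + excess 0 u v x / 2)) \<in> C_le M"
    using L2_diff[OF u d] L2_add[OF v d] by (auto simp: C_le_def excess_def max_def field_simps)
  \<comment> \<open>Where the displacement is positive, the shifted entries coincide while
    \<open>p - q\<close> is at most 0; elsewhere the product is 0.\<close>
  show "AE x in M. 0 \<le> excess 0 u v x / 2 *
      ((u x - excess 0 u v x / 2) - (v x + excess 0 u v x / 2) - (p x - q x))"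
    if "(p, q) \<in> C_le M" for p q
  proof -
    have "AE x in M. p x \<le> q x"
      using that by (simp add: C_le_def)
    then show ?thesis
      by eventually_elim (auto simp: excess_def max_def)
  qed
qed

lemma double_fun_proj_dist:
  assumes E: "L2_functional M E" and u: "u \<in> L2 M" and v: "v \<in> L2 M" and a: "0 \<le> a"
  shows "double_fun E (L2_proj M (C_dist M (ennreal a)) (u, v)) \<le> double_fun E (u, v) \<longleftrightarrow>
    shift_contracts E u v (\<lambda>x. excess a u v x / 2 - excess a v u x / 2)"
proof (rule double_fun_L2_proj[OF E _ u v])
  let ?d = "\<lambda>x. excess a u v x / 2 - excess a v u x / 2"
  show "C_dist M (ennreal a) \<subseteq> L2 M \<times> L2 M"
    by (auto simp: C_dist_def)
  show d: "?d \<in> L2 M"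
    using L2_scale[OF L2_diff[OF L2_excess[OF u v a] L2_excess[OF v u a]], of "1/2"]
    by (simp add: algebra_simps)
  have "\<bar>(u x - ?d x) - (v x + ?d x)\<bar> \<le> a" for x
    using a by (cases rule: excess_cases[of a u v x]) (simp_all add: a)
  then show "((\<lambda>x. u x - ?d x), (\<lambda>x. v x + ?d x)) \<in> C_dist M (ennreal a)"
    using L2_diff[OF u d] L2_add[OF v d] a by (simp add: C_dist_def)
  \<comment> \<open>Where the displacement is nonzero, the shifted difference sits at the wall
    \<open>a\<close> or \<open>- a\<close> on the side given by the sign of \<open>?d x\<close>, and
    \<open>p - q\<close> lies between the walls, so both factors have compatible signs.\<close>
  show "AE x in M. 0 \<le> ?d x * ((u x - ?d x) - (v x + ?d x) - (p x - q x))"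
    if "(p, q) \<in> C_dist M (ennreal a)" for p q
  proof -
    have "AE x in M. \<bar>p x - q x\<bar> \<le> a"
      using that a by (simp add: C_dist_def)
    then show ?thesis
    proof eventually_elim
      case (elim x)
      from a show ?case
      proof (cases rule: excess_cases[of a u v x])
        case above
        then have "(u x - ?d x) - (v x + ?d x) = a"
          by simp
        then show ?thesis
          using above elim by simp
      next
        case below
        then have "(u x - ?d x) - (v x + ?d x) = - a"
          by simp
        then show ?thesis
          using below elim by (simp add: mult_le_0_iff abs_le_iff)
      qed simp
    qed
  qed
qed

text \<open>The constraint set is the whole space, so the displacement is 0; the chosen point may
  still differ from \<open>(u, v)\<close> on a null set.\<close>

lemma double_fun_proj_infinity:
  assumes E: "L2_functional M E" and u: "u \<in> L2 M" and v: "v \<in> L2 M"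
  shows "double_fun E (L2_proj M (C_dist M \<infinity>) (u, v)) \<le> double_fun E (u, v)"
proof -
  have "(\<lambda>x. 0) \<in> L2 M"
    by (simp add: L2_def)
  moreover have "C_dist M \<infinity> = L2 M \<times> L2 M"
    by (auto simp: C_dist_def)
  ultimately show ?thesis
    using double_fun_L2_proj[OF E _ u v, of "C_dist M \<infinity>" "\<lambda>x. 0"] u v
    by (simp add: shift_contracts_def)
qed

text \<open>From here on the projections are gone: the infinite parameter is trivial, and the finite
  ones become inequalities for explicit displacements.\<close>

lemma markovian_iff:
  assumes E: "L2_functional M E"
  shows "markovian M E \<longleftrightarrow>
    (\<forall>u\<in>L2 M. \<forall>v\<in>L2 M. shift_contracts E u v (\<lambda>x. excess 0 u v x / 2)) \<and>
    (\<forall>u\<in>L2 M. \<forall>v\<in>L2 M. \<forall>a\<ge>0.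
       shift_contracts E u v (\<lambda>x. excess a u v x / 2 - excess a v u x / 2))"
    (is "_ \<longleftrightarrow> ?le \<and> ?dist")
proof -
  have "(\<forall>w \<in> L2 M \<times> L2 M. double_fun E (L2_proj M (C_le M) w) \<le> double_fun E w) \<longleftrightarrow> ?le"
    using double_fun_proj_le[OF E] by auto
  moreover have "(\<forall>w \<in> L2 M \<times> L2 M. \<forall>\<alpha>::ennreal.
      double_fun E (L2_proj M (C_dist M \<alpha>) w) \<le> double_fun E w) \<longleftrightarrow> ?dist" (is "?l \<longleftrightarrow> _")
  proof
    assume ?l
    then show ?dist
      using double_fun_proj_dist[OF E] by auto
  next
    assume dist: ?dist
    have "double_fun E (L2_proj M (C_dist M \<alpha>) (u, v)) \<le> double_fun E (u, v)"
      if "u \<in> L2 M" "v \<in> L2 M" for u v and \<alpha> :: ennreal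
    proof (cases \<alpha>)
      case (real a)
      then show ?thesis
        using dist that double_fun_proj_dist[OF E] by simp
    next
      case top
      then show ?thesis
        using double_fun_proj_infinity[OF E] that by (simp add: infinity_ennreal_def)
    qed
    then show ?l
      by auto
  qed
  ultimately show ?thesis
    by (simp add: markovian_def)
qed

section \<open>The pairs in (U) and (L) as displacements\<close>

lemma h_plus_excess: "(\<lambda>x. h_plus a (u x) (v x)) = (\<lambda>x. u x - excess a u v x)"
  by (simp add: h_plus_def excess_def fun_eq_iff min_def max_def)

lemma k_plus_excess: "(\<lambda>x. k_plus a (u x) (v x)) = (\<lambda>x. v x + excess a u v x)"
  by (simp add: k_plus_def excess_def fun_eq_iff max_def)

text \<open>Exchanging \<open>u\<close> and \<open>v\<close> turns one property into the other with
  its two components exchanged, which the symmetric sum does not notice.\<close>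

lemma strong_lower_iff_upper:
  "strong_lower_unit_contraction M E \<longleftrightarrow> strong_upper_unit_contraction M E"
proof -
  have swap: "h_minus a s t = k_plus a t s" "k_minus a s t = h_plus a t s" for a s t
    by (simp_all add: h_minus_def k_plus_def k_minus_def h_plus_def)
  have comm: "E f + E g \<le> E u + E v \<longleftrightarrow> E g + E f \<le> E v + E u" for f g u v
    by (simp only: add.commute)
  show ?thesis
    unfolding strong_lower_unit_contraction_def strong_upper_unit_contraction_def swap
    by (subst comm) blast
qed

section \<open>Telescoping\<close>

text \<open>Write N for \<open>Suc n\<close>. At t = i/N and s = (n-1-i)/N the remaining gap 1-t-s
  is 2/N, so the half step advances both arguments by 1/N. As i grows, \<open>\<phi>\<close> runs up
  the grid and \<open>\<psi>\<close> runs down it, and both sums of increments telescope. The grid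
  ends at n/N because a half step never reaches 1.\<close>

lemma telescoping_shift:
  fixes \<phi> \<psi> :: "real \<Rightarrow> real"
  assumes step: "\<And>t s. 0 \<le> t \<Longrightarrow> 0 \<le> s \<Longrightarrow> t + s < 1 \<Longrightarrow>
      \<phi> (t + (1 - t - s) / 2) + \<psi> (s + (1 - t - s) / 2) \<le> \<phi> t + \<psi> s"
  shows "\<phi> (real n / real (Suc n)) + \<psi> (real n / real (Suc n)) \<le> \<phi> 0 + \<psi> 0"
proof -
  let ?N = "real (Suc n)"
  have "\<phi> (real (Suc i) / ?N) - \<phi> (real i / ?N)
      \<le> \<psi> (real (n - Suc i) / ?N) - \<psi> (real (n - i) / ?N)" if "i < n" for i
  proof -
    define r where "r = inverse ?N"
    have "(real n + 1) * r = 1" "0 < r"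
      by (simp_all add: r_def field_simps)
    moreover have "real (n - Suc i) = real n - real i - 1" "real (n - i) = real n - real i"
      using that by (simp_all add: of_nat_diff)
    ultimately have "real n * r = 1 - r" "real (n - Suc i) * r = 1 - r - real i * r - r"
      "real (n - i) * r = 1 - r - real i * r" "real (Suc i) * r = real i * r + r" "0 < r"
      by (simp_all add: algebra_simps)
    then have
      "real i / ?N + (1 - real i / ?N - real (n - Suc i) / ?N) / 2 = real (Suc i) / ?N"
      "real (n - Suc i) / ?N + (1 - real i / ?N - real (n - Suc i) / ?N) / 2 = real (n - i) / ?N"
      "real i / ?N + real (n - Suc i) / ?N < 1"
      unfolding divide_inverse[of _ ?N] r_def[symmetric] by (simp_all add: field_simps)
    then show ?thesis
      using step[of "real i / ?N" "real (n - Suc i) / ?N"] by simp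
  qed
  then have "(\<Sum>i<n. \<phi> (real (Suc i) / ?N) - \<phi> (real i / ?N))
      \<le> (\<Sum>i<n. \<psi> (real (n - Suc i) / ?N) - \<psi> (real (n - i) / ?N))"
    by (intro sum_mono) simp
  moreover have "(\<Sum>i<n. \<phi> (real (Suc i) / ?N) - \<phi> (real i / ?N)) = \<phi> (real n / ?N) - \<phi> 0"
    using sum_lessThan_telescope[of "\<lambda>i. \<phi> (real i / ?N)" n] by simp
  moreover have "(\<Sum>i<n. \<psi> (real (n - Suc i) / ?N) - \<psi> (real (n - i) / ?N)) = \<psi> 0 - \<psi> (real n / ?N)"
    using sum_lessThan_telescope[of "\<lambda>i. \<psi> (real (n - i) / ?N)" n] by simp
  ultimately show ?thesis
    by linarith
qed

text \<open>Telescoping subtracts values, so both functions must first be shown finite on the whole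
  of [0,1); then the real version applies.\<close>

lemma telescoping_shift_ereal:
  fixes \<phi> \<psi> :: "real \<Rightarrow> ereal"
  assumes step: "\<And>t s. 0 \<le> t \<Longrightarrow> 0 \<le> s \<Longrightarrow> t + s < 1 \<Longrightarrow>
      \<phi> (t + (1 - t - s) / 2) + \<psi> (s + (1 - t - s) / 2) \<le> \<phi> t + \<psi> s"
    and mininf: "\<And>t. \<phi> t \<noteq> -\<infinity>" "\<And>t. \<psi> t \<noteq> -\<infinity>"
    and zero: "\<phi> 0 < \<infinity>" "\<psi> 0 < \<infinity>"
    and mono: "\<And>t T. 0 < t \<Longrightarrow> t < T \<Longrightarrow> \<phi> T < \<infinity> \<Longrightarrow> \<phi> t < \<infinity>"
      "\<And>t T. 0 < t \<Longrightarrow> t < T \<Longrightarrow> \<psi> T < \<infinity> \<Longrightarrow> \<psi> t < \<infinity>"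
  shows "\<phi> (real n / real (Suc n)) + \<psi> (real n / real (Suc n)) \<le> \<phi> 0 + \<psi> 0"
proof -
  have add: "x < \<infinity> \<and> y < \<infinity>" if "x + y \<le> z + w" "z < \<infinity>" "w < \<infinity>" "x \<noteq> -\<infinity>" "y \<noteq> -\<infinity>"
    for x y z w :: ereal
    using that by (cases x; cases y; cases z; cases w) auto
  \<comment> \<open>A step with one parameter equal to 0 halves the distance of the other from 1.
    This gives finiteness at points arbitrarily close to 1, and \<open>mono\<close> fills in the
    points between.\<close>
  have dyadic: "\<phi> (1 - (1/2) ^ k) < \<infinity> \<and> \<psi> (1 - (1/2) ^ k) < \<infinity>" for k
  proof (induction k)
    case 0
    then show ?case
      using zero by simp
  next
    case (Suc k)
    have *: "0 \<le> 1 - (1/2::real) ^ k" "1 - (1/2::real) ^ k < 1"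
      by (simp_all add: power_le_one)
    have **: "1 - (1/2) ^ k + (1 - (1 - (1/2) ^ k) - 0) / 2 = 1 - (1/2::real) ^ Suc k"
      "1 - (1/2) ^ k + (1 - 0 - (1 - (1/2) ^ k)) / 2 = 1 - (1/2::real) ^ Suc k"
      by (simp_all add: field_simps)
    show ?case
      using add[OF step[of "1 - (1/2) ^ k" 0]] add[OF step[of 0 "1 - (1/2) ^ k"]]
        Suc.IH zero mininf * unfolding ** by simp
  qed
  have fin: "\<bar>\<phi> t\<bar> \<noteq> \<infinity> \<and> \<bar>\<psi> t\<bar> \<noteq> \<infinity>" if t: "0 \<le> t" "t < 1" for t
  proof -
    obtain k where "(1/2) ^ k < 1 - t"
      using real_arch_pow_inv[of "1 - t" "1/2"] t by auto
    then have "t < 1 - (1/2) ^ k"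
      by simp
    then have "\<phi> t < \<infinity> \<and> \<psi> t < \<infinity>"
      using dyadic[of k] mono[of t "1 - (1/2) ^ k"] zero t by (cases "t = 0") auto
    then show ?thesis
      using mininf[of t] by auto
  qed
  define f where "f t = real_of_ereal (\<phi> t)" for t
  define g where "g t = real_of_ereal (\<psi> t)" for t
  have eq: "\<phi> t = ereal (f t)" "\<psi> t = ereal (g t)" if "0 \<le> t" "t < 1" for t
    using fin[OF that] by (auto simp: f_def g_def ereal_real')
  have "f (t + (1 - t - s) / 2) + g (s + (1 - t - s) / 2) \<le> f t + g s"
    if "0 \<le> t" "0 \<le> s" "t + s < 1" for t s
  proof -
    have "t + (1 - t - s) / 2 < 1" "s + (1 - t - s) / 2 < 1"
      using that by (simp_all add: field_simps)
    then show ?thesis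
      using step[OF that] that by (simp add: eq)
  qed
  then have "f (real n / real (Suc n)) + g (real n / real (Suc n)) \<le> f 0 + g 0"
    by (rule telescoping_shift)
  then show ?thesis
    by (simp add: eq)
qed

section \<open>Convex lower semicontinuous functionals\<close>

locale L2_energy =
  fixes M :: "'a measure" and E :: "('a \<Rightarrow> real) \<Rightarrow> ereal"
  assumes E: "L2_functional M E" and convex: "convex_fun M E" and lsc: "lsc_fun M E"
begin

lemma mininf: "u \<in> L2 M \<Longrightarrow> E u \<noteq> -\<infinity>"
  using E unfolding L2_functional_def by blast

lemma dom_L2: "u \<in> dom_fun M E \<Longrightarrow> u \<in> L2 M"
  by (simp add: dom_fun_def)

lemma dom_finite: "u \<in> dom_fun M E \<Longrightarrow> \<bar>E u\<bar> \<noteq> \<infinity>"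
  using mininf[of u] by (auto simp: dom_fun_def)

lemma dom_of_sum_le:
  assumes "u \<in> L2 M" "v \<in> L2 M" "f \<in> dom_fun M E" "g \<in> dom_fun M E" "E u + E v \<le> E f + E g"
  shows "u \<in> dom_fun M E \<and> v \<in> dom_fun M E"
proof -
  have "E f + E g < \<infinity>"
    using assms(3,4) by (simp add: dom_fun_def)
  with assms(5) have "E u + E v < \<infinity>"
    by order
  then show ?thesis
    using assms(1,2) mininf[of u] mininf[of v] by (simp add: dom_fun_def)
qed

lemma shift_dom:
  assumes "u \<in> dom_fun M E" "v \<in> dom_fun M E" "d \<in> L2 M" "shift_contracts E u v d"
  shows "(\<lambda>x. u x - d x) \<in> dom_fun M E \<and> (\<lambda>x. v x + d x) \<in> dom_fun M E"
  using dom_of_sum_le[OF L2_diff[OF dom_L2[OF assms(1)] assms(3)]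
      L2_add[OF dom_L2[OF assms(2)] assms(3)] assms(1,2)] assms(4)
  by (simp add: shift_contracts_def)

text \<open>Bridges the quantifier over the whole space in Markovianity and the one over the domain
  in (U): off the domain the right-hand side is infinite, because \<open>E\<close> avoids minus
  infinity.\<close>

lemma shift_contractsI:
  assumes "u \<in> L2 M" "v \<in> L2 M"
    and "u \<in> dom_fun M E \<Longrightarrow> v \<in> dom_fun M E \<Longrightarrow> shift_contracts E u v d"
  shows "shift_contracts E u v d"
proof (cases "u \<in> dom_fun M E \<and> v \<in> dom_fun M E")
  case False
  then have "E u + E v = \<infinity>"
    using assms mininf[of u] mininf[of v] by (auto simp: dom_fun_def)
  then show ?thesis
    unfolding shift_contracts_def by (simp only: ereal_less_eq)
qed (use assms in blast)

lemma lsc_liminf: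
  assumes u: "u \<in> L2 M" and f: "\<And>n. f n \<in> L2 M" and lim: "(\<lambda>n. L2_dist M u (f n)) \<longlonglongrightarrow> 0"
  shows "E u \<le> liminf (\<lambda>n. E (f n))"
  unfolding le_Liminf_iff
proof (intro allI impI)
  fix c assume "c < E u"
  then obtain \<delta> where \<delta>: "\<delta> > 0" "\<And>v. v \<in> L2 M \<Longrightarrow> L2_dist M u v < \<delta> \<Longrightarrow> c < E v"
    using lsc u unfolding lsc_fun_def by meson
  have "\<forall>\<^sub>F n in sequentially. L2_dist M u (f n) < \<delta>"
    using order_tendstoD(2)[OF lim \<delta>(1)] .
  then show "\<forall>\<^sub>F n in sequentially. c < E (f n)"
    by eventually_elim (use \<delta>(2) f in blast)
qed

text \<open>Carries a contraction inequality over to limits. Superadditivity of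
  \<open>liminf\<close> for extended reals must avoid opposite infinities, which the lower bounds
  \<open>E u\<close> and \<open>E v\<close> guarantee.\<close>

lemma lsc_sum:
  assumes u: "u \<in> L2 M" "\<And>n. f n \<in> L2 M" "(\<lambda>n. L2_dist M u (f n)) \<longlonglongrightarrow> 0"
    and v: "v \<in> L2 M" "\<And>n. g n \<in> L2 M" "(\<lambda>n. L2_dist M v (g n)) \<longlonglongrightarrow> 0"
    and le: "\<And>n. E (f n) + E (g n) \<le> c"
  shows "E u + E v \<le> c"
proof -
  have lu: "E u \<le> liminf (\<lambda>n. E (f n))" and lv: "E v \<le> liminf (\<lambda>n. E (g n))"
    using lsc_liminf u v by blast+
  then have "liminf (\<lambda>n. E (f n)) \<noteq> -\<infinity>" "liminf (\<lambda>n. E (g n)) \<noteq> -\<infinity>"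
    using mininf[OF u(1)] mininf[OF v(1)] by auto
  then have "liminf (\<lambda>n. E (f n)) + liminf (\<lambda>n. E (g n)) \<le> liminf (\<lambda>n. E (f n) + E (g n))"
    by (intro ereal_liminf_add_mono) auto
  also have "\<dots> \<le> liminf (\<lambda>n. c)"
    by (intro Liminf_mono) (simp add: le)
  also have "\<dots> = c"
    by (simp add: Liminf_const)
  finally show ?thesis
    using add_mono[OF lu lv] by order
qed

section \<open>Half displacements versus full displacements\<close>

lemma convex_line_finite:
  assumes u: "u \<in> dom_fun M E" and d: "d \<in> L2 M" and t: "0 < t" "t < T"
    and T: "E (\<lambda>x. u x + T * d x) < \<infinity>"
  shows "E (\<lambda>x. u x + t * d x) < \<infinity>"
proof -
  have uT: "(\<lambda>x. u x + T * d x) \<in> L2 M"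
    by (rule L2_add_scale[OF dom_L2[OF u] d])
  obtain r where r: "E u = ereal r"
    using dom_finite[OF u] by (cases "E u") simp_all
  obtain s where s: "E (\<lambda>x. u x + T * d x) = ereal s"
    using mininf[OF uT] T by (cases "E (\<lambda>x. u x + T * d x)") simp_all
  \<comment> \<open>The point at \<open>t\<close> is the convex combination of those at 0 and
    \<open>T\<close> with weight \<open>t / T\<close>. The resulting finiteness is the
    \<open>mono\<close> assumption of \<open>telescoping_shift_ereal\<close>.\<close>
  have "0 < t / T" "t / T < 1"
    using t by simp_all
  then have "E (\<lambda>x. (1 - t / T) * u x + t / T * (u x + T * d x))
      \<le> ereal (1 - t / T) * E u + ereal (t / T) * E (\<lambda>x. u x + T * d x)"
    by (intro convex[unfolded convex_fun_def, rule_format, OF dom_L2[OF u] uT] conjI)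
  also have "\<dots> = ereal ((1 - t / T) * r + t / T * s)"
    unfolding r s by (simp only: times_ereal.simps plus_ereal.simps)
  also have "\<dots> < \<infinity>"
    by simp
  also have "(\<lambda>x. (1 - t / T) * u x + t / T * (u x + T * d x)) = (\<lambda>x. u x + t * d x)"
  proof
    fix x
    have "(1 - t / T) * u x + t / T * (u x + T * d x) = u x + t / T * T * d x"
      by algebra
    then show "(1 - t / T) * u x + t / T * (u x + T * d x) = u x + t * d x"
      using t by simp
  qed
  finally show ?thesis .
qed

text \<open>After advancing by \<open>t\<close> and \<open>s\<close>, the displacement still to be
  made is \<open>(1 - t - s) * d\<close>, and \<open>step\<close> treats half of it. Telescoping
  reaches the parameter n/(n+1); lower semicontinuity takes it to 1.\<close>

lemma full_shift_of_half_shifts: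
  assumes u: "u \<in> dom_fun M E" and v: "v \<in> dom_fun M E" and d: "d \<in> L2 M"
    and step: "\<And>t s. 0 \<le> t \<Longrightarrow> 0 \<le> s \<Longrightarrow> t + s < 1 \<Longrightarrow>
      shift_contracts E (\<lambda>x. u x - t * d x) (\<lambda>x. v x + s * d x) (\<lambda>x. (1 - t - s) / 2 * d x)"
  shows "shift_contracts E u v d"
proof -
  define \<phi> where "\<phi> t = E (\<lambda>x. u x - t * d x)" for t
  define \<psi> where "\<psi> t = E (\<lambda>x. v x + t * d x)" for t
  let ?t = "\<lambda>n. real n / real (Suc n)"
  note uL = dom_L2[OF u] and vL = dom_L2[OF v]
  have "\<phi> (?t n) + \<psi> (?t n) \<le> \<phi> 0 + \<psi> 0" for n
  proof (rule telescoping_shift_ereal)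
    show "\<phi> (t + (1 - t - s) / 2) + \<psi> (s + (1 - t - s) / 2) \<le> \<phi> t + \<psi> s"
      if "0 \<le> t" "0 \<le> s" "t + s < 1" for t s
    proof -
      have "(\<lambda>x. u x - (t + (1 - t - s) / 2) * d x) = (\<lambda>x. u x - t * d x - (1 - t - s) / 2 * d x)"
        "(\<lambda>x. v x + (s + (1 - t - s) / 2) * d x) = (\<lambda>x. v x + s * d x + (1 - t - s) / 2 * d x)"
        by (auto simp: distrib_right diff_diff_eq add.assoc)
      then show ?thesis
        using step[OF that] by (simp only: \<phi>_def \<psi>_def shift_contracts_def)
    qed
    show "\<phi> t \<noteq> -\<infinity>" "\<psi> t \<noteq> -\<infinity>" for t
      unfolding \<phi>_def \<psi>_def by (intro mininf L2_diff_scale L2_add_scale uL vL d)+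
    show "\<phi> 0 < \<infinity>" "\<psi> 0 < \<infinity>"
      using u v by (simp_all add: \<phi>_def \<psi>_def dom_fun_def)
    show "\<phi> t < \<infinity>" if "0 < t" "t < T" "\<phi> T < \<infinity>" for t T
      using convex_line_finite[OF u L2_scale[OF d, of "-1"] that(1,2)] that(3)
      by (simp add: \<phi>_def)
    show "\<psi> t < \<infinity>" if "0 < t" "t < T" "\<psi> T < \<infinity>" for t T
      using convex_line_finite[OF v d that(1,2)] that(3) by (simp add: \<psi>_def)
  qed
  then have le: "E (\<lambda>x. u x - ?t n * d x) + E (\<lambda>x. v x + ?t n * d x) \<le> E u + E v" for n
    by (simp add: \<phi>_def \<psi>_def)
  have t: "?t \<longlonglongrightarrow> 1"
    by (rule LIMSEQ_n_over_Suc_n)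
  have lim: "(\<lambda>n. u x - ?t n * d x) \<longlonglongrightarrow> u x - d x" "(\<lambda>n. v x + ?t n * d x) \<longlonglongrightarrow> v x + d x" for x
    using tendsto_diff[OF tendsto_const[of "u x"] tendsto_mult[OF t tendsto_const[of "d x"]]]
      tendsto_add[OF tendsto_const[of "v x"] tendsto_mult[OF t tendsto_const[of "d x"]]]
    by simp_all
  \<comment> \<open>The error is (1 - n/(n+1)) times \<open>d\<close>, so \<open>d\<close> serves as
    the majorant.\<close>
  have bound: "\<bar>(u x - d x) - (u x - ?t n * d x)\<bar> \<le> \<bar>d x\<bar>"
    "\<bar>(v x + d x) - (v x + ?t n * d x)\<bar> \<le> \<bar>d x\<bar>" for n x
  proof -
    have "\<bar>(1 - ?t n) * d x\<bar> \<le> 1 * \<bar>d x\<bar>"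
      unfolding abs_mult by (intro mult_right_mono) (auto simp: field_simps)
    moreover have "(u x - d x) - (u x - ?t n * d x) = - ((1 - ?t n) * d x)"
      "(v x + d x) - (v x + ?t n * d x) = (1 - ?t n) * d x"
      by (simp_all add: left_diff_distrib)
    ultimately show "\<bar>(u x - d x) - (u x - ?t n * d x)\<bar> \<le> \<bar>d x\<bar>"
      "\<bar>(v x + d x) - (v x + ?t n * d x)\<bar> \<le> \<bar>d x\<bar>"
      by (simp_all only: abs_minus_cancel mult_1)
  qed
  have u': "(\<lambda>x. u x - d x) \<in> L2 M" "\<And>n. (\<lambda>x. u x - ?t n * d x) \<in> L2 M"
    and v': "(\<lambda>x. v x + d x) \<in> L2 M" "\<And>n. (\<lambda>x. v x + ?t n * d x) \<in> L2 M"
    using uL vL d by (simp_all only: L2_diff L2_add L2_scale)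
  show ?thesis
    unfolding shift_contracts_def
  proof (rule lsc_sum)
    show "(\<lambda>n. L2_dist M (\<lambda>x. u x - d x) (\<lambda>x. u x - ?t n * d x)) \<longlonglongrightarrow> 0"
      by (rule L2_dist_tendsto_0[where g = d]) (rule u' d lim bound)+
    show "(\<lambda>n. L2_dist M (\<lambda>x. v x + d x) (\<lambda>x. v x + ?t n * d x)) \<longlonglongrightarrow> 0"
      by (rule L2_dist_tendsto_0[where g = d]) (rule v' d lim bound)+
  qed (rule u' v' le)+
qed

text \<open>The half-shifted pair is the midpoint of the original and the fully shifted pair, so
  convexity bounds its energy by the average of theirs.\<close>

lemma half_shift_of_full_shift:
  assumes u: "u \<in> dom_fun M E" and v: "v \<in> dom_fun M E" and d: "d \<in> L2 M"
    and full: "shift_contracts E u v d"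
  shows "shift_contracts E u v (\<lambda>x. d x / 2)"
proof -
  have midpoint: "E (\<lambda>x. (f x + g x) / 2) \<le> ereal (1/2) * (E f + E g)"
    if f: "f \<in> dom_fun M E" and g: "g \<in> dom_fun M E" for f g
  proof -
    have "E (\<lambda>x. (1 - 1/2) * f x + 1/2 * g x) \<le> ereal (1 - 1/2) * E f + ereal (1/2) * E g"
      by (rule convex[unfolded convex_fun_def, rule_format, OF dom_L2[OF f] dom_L2[OF g]]) simp
    also have "\<dots> = ereal (1/2) * (E f + E g)"
      using dom_finite[OF f] dom_finite[OF g] by (cases "E f"; cases "E g") auto
    finally show ?thesis
      by (simp add: add_divide_distrib)
  qed
  have ud: "(\<lambda>x. u x - d x) \<in> dom_fun M E" and vd: "(\<lambda>x. v x + d x) \<in> dom_fun M E"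
    using shift_dom[OF u v d full] by simp_all
  have "(\<lambda>x. u x - d x / 2) = (\<lambda>x. (u x + (u x - d x)) / 2)"
    "(\<lambda>x. v x + d x / 2) = (\<lambda>x. (v x + (v x + d x)) / 2)"
    by (auto simp: field_simps)
  then have "E (\<lambda>x. u x - d x / 2) + E (\<lambda>x. v x + d x / 2)
      \<le> ereal (1/2) * (E u + E (\<lambda>x. u x - d x)) + ereal (1/2) * (E v + E (\<lambda>x. v x + d x))"
    using add_mono[OF midpoint[OF u ud] midpoint[OF v vd]] by simp
  also have "\<dots> \<le> E u + E v"
  proof -
    obtain p q r s where eq: "E u = ereal p" "E v = ereal q"
      "E (\<lambda>x. u x - d x) = ereal r" "E (\<lambda>x. v x + d x) = ereal s"
      using dom_finite[OF u] dom_finite[OF v] dom_finite[OF ud] dom_finite[OF vd] by auto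
    then have "r + s \<le> p + q"
      using full by (simp add: shift_contracts_def)
    then have "(p + r) / 2 + (q + s) / 2 \<le> p + q"
      by argo
    then show ?thesis
      by (simp add: eq)
  qed
  finally show ?thesis
    by (simp add: shift_contracts_def)
qed

section \<open>Markovianity versus (U)\<close>

lemma strong_upper_iff:
  "strong_upper_unit_contraction M E \<longleftrightarrow>
    (\<forall>u\<in>dom_fun M E. \<forall>v\<in>dom_fun M E. \<forall>a>0. shift_contracts E u v (excess a u v))"
proof -
  \<comment> \<open>The domain clauses of (U) follow from its inequality, since a finite sum of
    values above minus infinity has finite terms.\<close>
  have "((\<lambda>x. h_plus a (u x) (v x)) \<in> dom_fun M E \<and>
      (\<lambda>x. k_plus a (u x) (v x)) \<in> dom_fun M E \<and>
      E (\<lambda>x. h_plus a (u x) (v x)) + E (\<lambda>x. k_plus a (u x) (v x)) \<le> E u + E v)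
    \<longleftrightarrow> shift_contracts E u v (excess a u v)"
    if "u \<in> dom_fun M E" "v \<in> dom_fun M E" "a > 0" for u v a
    using that shift_dom[OF that(1,2) L2_excess]
    unfolding h_plus_excess[of a u v] k_plus_excess[of a u v]
    by (auto simp: dom_L2 shift_contracts_def)
  then show ?thesis
    unfolding strong_upper_unit_contraction_def by (simp cong: ball_cong)
qed

text \<open>Where \<open>u - v\<close> exceeds \<open>a\<close>, the shifts use up the fraction
  \<open>t + s\<close> of the excess without overshooting; elsewhere nothing moves. This matches the
  projection inequality at the moved pair with the \<open>step\<close> of
  \<open>full_shift_of_half_shifts\<close>.\<close>

lemma excess_of_shifted:
  assumes "0 \<le> t" "0 \<le> s" "t + s \<le> 1"
  shows "excess a (\<lambda>x. u x - t * excess a u v x) (\<lambda>x. v x + s * excess a u v x) =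
    (\<lambda>x. (1 - t - s) * excess a u v x)"
proof
  fix x
  let ?r = "u x - v x - a"
  show "excess a (\<lambda>x. u x - t * excess a u v x) (\<lambda>x. v x + s * excess a u v x) x =
    (1 - t - s) * excess a u v x"
  proof (cases "?r \<le> 0")
    case True
    then show ?thesis
      by (simp add: excess_def max_def)
  next
    case False
    then have "excess a u v x = ?r"
      by (simp add: excess_def)
    moreover have "u x - t * ?r - (v x + s * ?r) - a = (1 - t - s) * ?r"
      by (simp add: algebra_simps)
    moreover have "0 \<le> (1 - t - s) * ?r"
      using False assms by simp
    ultimately show ?thesis
      by (simp add: excess_def)
  qed
qed

text \<open>The shifts reduce \<open>u - v\<close> by at most the excess, which is at most
  \<open>u - v\<close> itself, so the order of the pair survives and the opposite wall of the strip
  is never crossed. This is where the restriction to ordered pairs enters.\<close>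

lemma reverse_excess_of_shifted:
  assumes "0 \<le> t" "0 \<le> s" "t + s \<le> 1" "0 \<le> a" and le: "\<And>x. v x \<le> u x"
  shows "excess a (\<lambda>x. v x + s * excess a u v x) (\<lambda>x. u x - t * excess a u v x) = (\<lambda>x. 0)"
proof
  fix x
  have "(t + s) * excess a u v x \<le> 1 * excess a u v x"
    using assms by (intro mult_right_mono) (auto simp: excess_def)
  moreover have "excess a u v x \<le> u x - v x"
    using le[of x] \<open>0 \<le> a\<close> by (simp add: excess_def)
  ultimately show "excess a (\<lambda>x. v x + s * excess a u v x) (\<lambda>x. u x - t * excess a u v x) x = 0"
    using \<open>0 \<le> a\<close> unfolding excess_def[of a "\<lambda>x. v x + _ x"] by (simp add: distrib_right)
qed

lemma strong_upper_of_markovian: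
  assumes "markovian M E"
  shows "strong_upper_unit_contraction M E"
  unfolding strong_upper_iff
proof (intro ballI allI impI)
  have le: "shift_contracts E u v (\<lambda>x. excess 0 u v x / 2)"
    if "u \<in> L2 M" "v \<in> L2 M" for u v
    using assms that by (simp add: markovian_iff[OF E])
  have dist: "shift_contracts E u v (\<lambda>x. excess a u v x / 2 - excess a v u x / 2)"
    if "u \<in> L2 M" "v \<in> L2 M" "0 \<le> a" for u v a
    using assms that by (simp add: markovian_iff[OF E])
  \<comment> \<open>At parameter 0 the shifted pair is the pointwise minimum and maximum, so this is
    the lattice inequality.\<close>
  have lattice: "shift_contracts E u v (excess 0 u v)"
    if u: "u \<in> dom_fun M E" and v: "v \<in> dom_fun M E" for u v
  proof (rule full_shift_of_half_shifts[OF u v])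
    show d: "excess 0 u v \<in> L2 M"
      using u v by (simp add: L2_excess dom_L2)
    show "shift_contracts E (\<lambda>x. u x - t * excess 0 u v x) (\<lambda>x. v x + s * excess 0 u v x)
        (\<lambda>x. (1 - t - s) / 2 * excess 0 u v x)"
      if "0 \<le> t" "0 \<le> s" "t + s < 1" for t s
      using le[OF L2_diff_scale[OF dom_L2[OF u] d] L2_add_scale[OF dom_L2[OF v] d], of t s]
        excess_of_shifted[of t s 0 u v] that
      by simp
  qed
  fix u v and a :: real
  assume u: "u \<in> dom_fun M E" and v: "v \<in> dom_fun M E" and a: "0 < a"
  define d where "d = excess a u v"
  have d: "d \<in> L2 M"
    using u v a by (simp add: d_def L2_excess dom_L2)
  \<comment> \<open>This is the pointwise maximum of \<open>u\<close> and \<open>v\<close>.\<close>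
  define m where "m = (\<lambda>x. v x + excess 0 u v x)"
  have m: "m \<in> dom_fun M E"
    using shift_dom[OF u v L2_excess lattice[OF u v]] u v by (simp add: m_def dom_L2)
  \<comment> \<open>\<open>m\<close> differs from \<open>u\<close> only where \<open>u < v\<close>,
    and there neither \<open>u - v\<close> nor \<open>m - v\<close> exceeds
    \<open>a\<close>.\<close>
  have "excess a m v x = d x" for x
    using a unfolding d_def m_def excess_def by linarith
  then have dm: "excess a m v = d"
    by blast
  have "shift_contracts E m v d"
  proof (rule full_shift_of_half_shifts[OF m v d])
    fix t s :: real
    assume ts: "0 \<le> t" "0 \<le> s" "t + s < 1"
    have "v x \<le> m x" for x
      by (simp add: m_def excess_def)
    then show "shift_contracts E (\<lambda>x. m x - t * d x) (\<lambda>x. v x + s * d x) (\<lambda>x. (1 - t - s) / 2 * d x)"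
      using dist[OF L2_diff_scale[OF dom_L2[OF m] d] L2_add_scale[OF dom_L2[OF v] d], of a t s]
        excess_of_shifted[of t s a m v] reverse_excess_of_shifted[of t s a v m] ts a
      unfolding dm by simp
  qed
  then have md: "(\<lambda>x. m x - d x) \<in> dom_fun M E" and vd: "(\<lambda>x. v x + d x) \<in> dom_fun M E"
    and le1: "E (\<lambda>x. m x - d x) + E (\<lambda>x. v x + d x) \<le> E m + E v"
    using shift_dom[OF m v d] by (simp_all add: shift_contracts_def)
  \<comment> \<open>The minimum of \<open>u\<close> and \<open>m - d\<close> is \<open>u - d\<close>
    and their maximum is \<open>m\<close>: where \<open>u < v\<close> the displacement is 0, and
    elsewhere \<open>m = u\<close>.\<close>
  have "excess 0 u (\<lambda>x. m x - d x) x = d x" for x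
    using a unfolding d_def m_def excess_def by linarith
  then have d0: "excess 0 u (\<lambda>x. m x - d x) = d"
    by blast
  have le2: "E (\<lambda>x. u x - d x) + E m \<le> E u + E (\<lambda>x. m x - d x)"
    using lattice[OF u md] unfolding d0 by (simp add: shift_contracts_def)
  have ud: "(\<lambda>x. u x - d x) \<in> dom_fun M E"
    using dom_of_sum_le[OF L2_diff[OF dom_L2[OF u] d] dom_L2[OF m] u md le2] by simp
  \<comment> \<open>Adding \<open>le1\<close> and \<open>le2\<close> cancels the energies of
    \<open>m\<close> and \<open>m - d\<close>, which is legitimate because all values are
    finite.\<close>
  obtain p q r s u' v' where "E u = ereal p" "E v = ereal q" "E m = ereal r"
    "E (\<lambda>x. m x - d x) = ereal s" "E (\<lambda>x. u x - d x) = ereal u'" "E (\<lambda>x. v x + d x) = ereal v'"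
    using dom_finite[OF u] dom_finite[OF v] dom_finite[OF m] dom_finite[OF md]
      dom_finite[OF ud] dom_finite[OF vd] by fastforce
  with le1 le2 show "shift_contracts E u v (excess a u v)"
    by (simp add: shift_contracts_def d_def[symmetric])
qed

lemma markovian_of_strong_upper:
  assumes "strong_upper_unit_contraction M E"
  shows "markovian M E"
proof -
  have pos: "shift_contracts E u v (excess a u v)"
    if "u \<in> dom_fun M E" "v \<in> dom_fun M E" "0 < a" for u v a
    using assms that by (simp add: strong_upper_iff)
  \<comment> \<open>(U) covers positive parameters only; parameter 0 is reached along 1/(n+1), with
    the excess at 0 as majorant.\<close>
  have zero: "shift_contracts E u v (excess 0 u v)"
    if u: "u \<in> dom_fun M E" and v: "v \<in> dom_fun M E" for u v
  proof -
    note uL = dom_L2[OF u] and vL = dom_L2[OF v]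
    define d where "d n = excess (inverse (real (Suc n))) u v" for n
    have d: "d n \<in> L2 M" for n
      using uL vL by (simp add: d_def L2_excess)
    have d0: "excess 0 u v \<in> L2 M"
      using uL vL by (simp add: L2_excess)
    have "(\<lambda>n. max 0 (u x - v x - inverse (real (Suc n)))) \<longlonglongrightarrow> max 0 (u x - v x - 0)" for x
      by (intro tendsto_intros LIMSEQ_inverse_real_of_nat)
    then have lim: "(\<lambda>n. d n x) \<longlonglongrightarrow> excess 0 u v x" for x
      by (simp add: d_def excess_def)
    have bound: "\<bar>excess 0 u v x - d n x\<bar> \<le> \<bar>excess 0 u v x\<bar>" for n x
      using inverse_nonnegative_iff_nonnegative[of "real (Suc n)"]
      unfolding d_def excess_def by linarith
    show ?thesis
      unfolding shift_contracts_def
    proof (rule lsc_sum)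
      show "(\<lambda>n. L2_dist M (\<lambda>x. u x - excess 0 u v x) (\<lambda>x. u x - d n x)) \<longlonglongrightarrow> 0"
        using bound by (intro L2_dist_tendsto_0[OF _ _ d0] L2_diff uL d d0 tendsto_intros lim)
          (simp add: abs_minus_commute)
      show "(\<lambda>n. L2_dist M (\<lambda>x. v x + excess 0 u v x) (\<lambda>x. v x + d n x)) \<longlonglongrightarrow> 0"
        using bound by (intro L2_dist_tendsto_0[OF _ _ d0] L2_add vL d d0 tendsto_intros lim) simp
      show "E (\<lambda>x. u x - d n x) + E (\<lambda>x. v x + d n x) \<le> E u + E v" for n
        using pos[OF u v, of "inverse (real (Suc n))"] by (simp add: shift_contracts_def d_def)
    qed (intro L2_diff L2_add uL vL d d0)+
  qed
  have half: "shift_contracts E u v (\<lambda>x. excess a u v x / 2)"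
    if "u \<in> dom_fun M E" "v \<in> dom_fun M E" "0 \<le> a" for u v a
    using that pos zero
    by (intro half_shift_of_full_shift L2_excess dom_L2) (auto simp: order_le_less)
  have dist: "shift_contracts E u v (\<lambda>x. excess a u v x / 2 - excess a v u x / 2)"
    if u: "u \<in> dom_fun M E" and v: "v \<in> dom_fun M E" and a: "0 \<le> a" for u v a
  proof -
    \<comment> \<open>Project onto \<open>u - v \<le> a\<close> first, then project the result onto
      the opposite half space.\<close>
    define f where "f = (\<lambda>x. u x - excess a u v x / 2)"
    define g where "g = (\<lambda>x. v x + excess a u v x / 2)"
    have "(\<lambda>x. excess a u v x / 2) \<in> L2 M"
      using L2_scale[OF L2_excess[OF dom_L2[OF u] dom_L2[OF v] a], of "1/2"] by simp
    from shift_dom[OF u v this half[OF u v a]]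
    have fg: "f \<in> dom_fun M E" "g \<in> dom_fun M E"
      by (simp_all add: f_def g_def)
    \<comment> \<open>The first projection does not disturb the second: where it acts, it leaves
      \<open>f - g = a\<close>, so the reverse excess is still 0.\<close>
    have "excess a g f x = excess a v u x" for x
      using a
    proof (cases rule: excess_cases[of a u v x])
      case above
      then have "g x - f x - a = - 2 * a"
        by (simp add: f_def g_def field_simps)
      then show ?thesis
        using above a by (simp add: excess_def[of a g f])
    qed (simp_all add: f_def g_def excess_def)
    then have "excess a g f = excess a v u"
      by blast
    then have "E (\<lambda>x. g x - excess a v u x / 2) + E (\<lambda>x. f x + excess a v u x / 2) \<le> E g + E f"
      using half[OF fg(2,1) a] by (simp add: shift_contracts_def)
    also have "\<dots> \<le> E u + E v"
      using half[OF u v a] by (simp add: shift_contracts_def f_def g_def add.commute)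
    also have "(\<lambda>x. g x - excess a v u x / 2) = (\<lambda>x. v x + (excess a u v x / 2 - excess a v u x / 2))"
      by (simp add: g_def add_diff_eq)
    also have "(\<lambda>x. f x + excess a v u x / 2) = (\<lambda>x. u x - (excess a u v x / 2 - excess a v u x / 2))"
      by (simp add: f_def diff_diff_eq2 diff_add_eq)
    finally show ?thesis
      by (simp only: shift_contracts_def add.commute)
  qed
  show ?thesis
    unfolding markovian_iff[OF E]
  proof (intro conjI ballI allI impI)
    fix u v assume uv: "u \<in> L2 M" "v \<in> L2 M"
    show "shift_contracts E u v (\<lambda>x. excess 0 u v x / 2)"
      by (rule shift_contractsI[OF uv half]) simp_all
    show "shift_contracts E u v (\<lambda>x. excess a u v x / 2 - excess a v u x / 2)" if "0 \<le> a" for a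
      by (rule shift_contractsI[OF uv dist]) (simp_all add: that)
  qed
qed

end

theorem proposition1p1:
  fixes M :: "'a measure" and E :: "('a \<Rightarrow> real) \<Rightarrow> ereal"
  assumes "sigma_finite_measure M"
    and "L2_functional M E"
    and "proper_fun M E"
    and "convex_fun M E"
    and "lsc_fun M E"
  shows "(markovian M E \<longleftrightarrow> strong_upper_unit_contraction M E) \<and>
         (markovian M E \<longleftrightarrow> strong_lower_unit_contraction M E)"
proof -
  interpret L2_energy M E
    using assms by unfold_locales
  show ?thesis
    using strong_upper_of_markovian markovian_of_strong_upper strong_lower_iff_upper by blast
qed

end
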